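(* Let $n_0(3)=4$, $n_0(4)=5$ and $n_0(6)=11$. Then for every $t\in\{3,4,6\}$ and every integer $n\ge n_0(t)$ with $\gcd(n,t)=1$, there exists a Universal Cycle for $t$-multisets of $[n]=\{1,\ldots,n\}$.
   Context: A Universal Cycle for $t$-multisets of $[n]$ (a $t$-Mcycle) is a cyclic sequence $a_1a_2\cdots a_k$ of $k=\binom{n+t-1}{t}$ entries from $[n]$ such that the $k$ multisets $\{a_i,a_{i+1},\ldots,a_{i+t-1}\}$ ($i=1,\ldots,k$, indices taken cyclically modulo $k$) are pairwise distinct; equivalently, every $t$-multiset of $[n]$ appears exactly once as the multiset of $t$ cyclically consecutive entries. *)

theory Defs
  imports Complex_Main "HOL-Library.Multiset"
begin

(* Positions are 0-based, so the window at i consists of the entries at i, ..., i + t - 1. *)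
definition cyclic_window :: "nat \<Rightarrow> 'a list \<Rightarrow> nat \<Rightarrow> 'a multiset" where
  "cyclic_window t xs i = mset (map (\<lambda>j. xs ! ((i + j) mod length xs)) [0..<t])"

(* The list xs is one period of the cyclic sequence, read from an arbitrary starting point. *)
definition is_Mcycle :: "nat \<Rightarrow> nat \<Rightarrow> nat list \<Rightarrow> bool" where
  "is_Mcycle t n xs \<longleftrightarrow>
     length xs = (n + t - 1) choose t \<and>
     set xs \<subseteq> {1..n} \<and>
     inj_on (cyclic_window t xs) {..<length xs}"

end

theory Submission
  imports Defs "Graph_Theory.Euler"
begin

text \<open>
  Arrange the elements of \<open>\<int>/n\<close> on a circle. A \<open>t\<close>-multiset has \<open>t\<close> cyclic gaps, which are
  nonnegative and sum to \<open>n\<close>. For \<open>t \<in> {3, 4, 6}\<close> and \<open>n\<close> coprime to \<open>t\<close>, some gap value occurs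
  exactly once, since a partition of \<open>t\<close> without parts equal to 1 has all parts divisible by 2 or all
  divisible by 3. Choose such a value as a function of the multiset of gaps only and list the elements
  in cyclic order so that the chosen gap is omitted. This turns the \<open>t\<close>-multisets into the
  arcs of a digraph on \<open>(t - 1)\<close>-words. As the choice ignores the order of the gaps, rotating the
  \<open>t - 1\<close> listed gaps maps each arc to a successor arc and is a bijection, so the digraph is
  balanced. It is connected: in a cyclic gap word one gap at a time may be changed, and setting a
  largest gap to 0 makes the omitted gap the strict maximum, so every word can be reduced to
  \<open>0 \<dots> 0\<close>; the word \<open>0 \<dots> 0 1\<close> links the translates of the latter. An Eulerian circuit is the
  desired cycle.
\<close>

subsection \<open>Eulerian circuits\<close>

lemma cas_consecutive:
  assumes "pre_digraph.cas G u p v" "p \<noteq> []"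
  shows "tail G (p ! 0) = u" "head G (last p) = v"
    and "Suc i < length p \<Longrightarrow> tail G (p ! Suc i) = head G (p ! i)"
proof -
  show "tail G (p ! 0) = u"
    using assms by (cases p) (auto simp: pre_digraph.cas.simps)
  show "head G (last p) = v"
    using assms by (induction p arbitrary: u) (auto simp: pre_digraph.cas.simps)
  show "Suc i < length p \<Longrightarrow> tail G (p ! Suc i) = head G (p ! i)"
    using assms
  proof (induction p arbitrary: u i)
    case (Cons e es)
    then obtain e' es' where es: "es = e' # es'" by (cases es) auto
    show ?case
      using Cons by (cases i) (auto simp: pre_digraph.cas.simps es)
  qed simp
qed

text \<open>\<open>\<rho>\<close> matches the arcs entering a vertex with those leaving it, so in-
  and out-degrees agree. The hypothesis \<open>conn\<close> is connectivity phrased as an induction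
  principle: a property that respects \<open>\<rho>\<close> and common sources spreads from
  \<open>e0\<close> to all arcs.\<close>

lemma eulerian_circuit_if_successor_bij:
  fixes src tgt :: "'e \<Rightarrow> 'v"
  assumes fin: "finite E" and e0: "e0 \<in> E"
    and bij: "bij_betw \<rho> E E" and succ: "\<And>e. e \<in> E \<Longrightarrow> src (\<rho> e) = tgt e"
    and conn: "\<And>Q e. \<lbrakk>Q e0; \<And>e. e \<in> E \<Longrightarrow> Q (\<rho> e) \<longleftrightarrow> Q e;
        \<And>e e'. \<lbrakk>e \<in> E; e' \<in> E; src e = src e'\<rbrakk> \<Longrightarrow> Q e \<longleftrightarrow> Q e'; e \<in> E\<rbrakk> \<Longrightarrow> Q e"
  obtains p where "distinct p" "set p = E"
    "\<And>i. i < length p \<Longrightarrow> src (p ! (Suc i mod length p)) = tgt (p ! i)"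
proof -
  define G where "G = \<lparr>verts = src ` E, arcs = E, tail = src, head = tgt\<rparr>"
  have G: "verts G = src ` E" "arcs G = E" "tail G = src" "head G = tgt"
    by (simp_all add: G_def)
  have \<rho>E: "\<rho> e \<in> E" if "e \<in> E" for e
    using bij that by (auto simp: bij_betw_def)
  have tgtE: "tgt e \<in> src ` E" if "e \<in> E" for e
    using succ[OF that] \<rho>E[OF that] by (metis imageI)
  interpret fin_digraph G
    by unfold_locales (auto simp: G fin tgtE)
  interpret S: pair_fin_digraph "mk_symmetric G" ..
  let ?r = "\<lambda>u v. u \<rightarrow>\<^sup>*\<^bsub>mk_symmetric G\<^esub> v"
  have arc: "?r (src e) (tgt e)" if "e \<in> E" for e
    using that by (intro S.reachable_adjI) (auto simp: mk_symmetric_def G)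
  have sym: "?r v u" if "?r u v" for u v
    using symmetric_mk_symmetric that by (rule symmetric_reachable)
  have vs: "verts (mk_symmetric G) = src ` E"
    by (simp add: mk_symmetric_def G)
  \<comment> \<open>Reachability of \<open>src e0\<close> in the symmetric closure is a property of
    the kind that \<open>conn\<close> propagates.\<close>
  have base: "?r (src e) (src e0)" if "e \<in> E" for e
  proof (rule conn[where Q = "\<lambda>e. ?r (src e) (src e0)"])
    show "?r (src e0) (src e0)" using e0 vs by (intro S.reachable_refl) auto
    show "?r (src (\<rho> e)) (src e0) \<longleftrightarrow> ?r (src e) (src e0)" if "e \<in> E" for e
      using arc[OF that] sym succ[OF that] S.reachable_trans by metis
  qed (use that in auto)
  have "connected G"
  proof (rule connectedI)
    show "verts G \<noteq> {}" using e0 G by auto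
    show "?r u v" if "u \<in> verts G" "v \<in> verts G" for u v
      using that base sym S.reachable_trans unfolding G by (metis imageE)
  qed
  moreover have "in_degree G u = out_degree G u" if "u \<in> verts G" for u
  proof -
    have "bij_betw \<rho> (in_arcs G u) (out_arcs G u)"
      unfolding bij_betw_def
    proof
      show "inj_on \<rho> (in_arcs G u)"
        using bij by (auto simp: bij_betw_def in_arcs_def G inj_on_def)
      show "\<rho> ` in_arcs G u = out_arcs G u"
      proof
        show "\<rho> ` in_arcs G u \<subseteq> out_arcs G u"
          using succ \<rho>E by (auto simp: in_arcs_def out_arcs_def G)
        show "out_arcs G u \<subseteq> \<rho> ` in_arcs G u"
        proof
          fix e assume "e \<in> out_arcs G u"
          then have e: "e \<in> E" "src e = u" by (auto simp: out_arcs_def G)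
          then obtain e' where "e' \<in> E" "e = \<rho> e'"
            using bij by (auto simp: bij_betw_def)
          with e succ show "e \<in> \<rho> ` in_arcs G u" by (auto simp: in_arcs_def G)
        qed
      qed
    qed
    then show ?thesis
      by (simp add: in_degree_def out_degree_def bij_betw_same_card)
  qed
  ultimately obtain u p where "euler_trail u p u"
    using closed_euler1 by blast
  then have p: "distinct p" "set p = E" "cas u p u"
    by (auto simp: euler_trail_def trail_def awalk_def G)
  have "src (p ! (Suc i mod length p)) = tgt (p ! i)" if "i < length p" for i
  proof (cases "Suc i < length p")
    case True
    then have "p \<noteq> []" by auto
    with True cas_consecutive(3)[OF p(3)] show ?thesis by (simp add: G)
  next
    case False
    with that have "Suc i = length p" "p \<noteq> []" by auto
    then have "p ! i = last p" by (metis diff_Suc_1 last_conv_nth)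
    then show ?thesis
      using \<open>Suc i = length p\<close> cas_consecutive(1,2)[OF p(3) \<open>p \<noteq> []\<close>] by (simp add: G)
  qed
  with p that show ?thesis by blast
qed

subsection \<open>Walks on the circle\<close>

lemma mod_add_right_cancel:
  fixes x y d n :: nat
  assumes "(x + d) mod n = (y + d) mod n" "x < n" "y < n"
  shows "x = y"
proof -
  have "int x mod int n = int y mod int n"
    using arg_cong[OF assms(1), of int]
    by (simp add: zmod_int) (metis add_diff_cancel_right' mod_diff_left_eq)
  then show ?thesis using assms(2,3) by simp
qed

text \<open>The last gap is never added: \<open>t\<close> gaps give \<open>t\<close> points, and the
  final gap only closes the circle.\<close>

fun walk_mod :: "nat \<Rightarrow> nat \<Rightarrow> nat list \<Rightarrow> nat list" where
  "walk_mod n x [] = []"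
| "walk_mod n x (d # D) = x mod n # walk_mod n (x + d) D"

lemma length_walk_mod [simp]: "length (walk_mod n x D) = length D"
  by (induction D arbitrary: x) auto

lemma walk_mod_mod: "walk_mod n (x mod n) D = walk_mod n x D"
proof (induction D arbitrary: x)
  case (Cons d D)
  show ?case
    using Cons[of "x mod n + d"] Cons[of "x + d"] by (simp add: mod_add_left_eq)
qed simp

lemma walk_mod_snoc: "walk_mod n x (D @ [d]) = walk_mod n x D @ [(x + sum_list D) mod n]"
  by (induction D arbitrary: x) (auto simp: add.assoc)

lemma nth_walk_mod: "i < length D \<Longrightarrow> walk_mod n x D ! i = (x + sum_list (take i D)) mod n"
proof (induction D arbitrary: x i)
  case (Cons d D)
  then show ?case by (cases i) (auto simp: add.assoc)
qed simp

lemma set_walk_mod: "n > 0 \<Longrightarrow> set (walk_mod n x D) \<subseteq> {..<n}"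
  by (induction D arbitrary: x) auto

text \<open>Moving the base past one gap transfers the first point \<open>x\<close> to the end,
  where it recurs as \<open>x + n\<close>.\<close>

lemma mset_walk_mod_rotate:
  assumes "sum_list (A @ B) = n"
  shows "mset (walk_mod n ((x + sum_list A) mod n) (B @ A)) = mset (walk_mod n x (A @ B))"
  using assms
proof (induction A arbitrary: x B)
  case Nil
  then show ?case by (simp add: walk_mod_mod)
next
  case (Cons a A)
  have "mset (walk_mod n ((x + a + sum_list A) mod n) ((B @ [a]) @ A)) =
      mset (walk_mod n (x + a) (A @ B @ [a]))"
    using Cons.IH[of "B @ [a]" "x + a"] Cons.prems by simp
  also have "\<dots> = mset (walk_mod n x ((a # A) @ B))"
  proof -
    have "(x + a + sum_list (A @ B)) mod n = (x + n) mod n"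
      using Cons.prems by (simp add: add.assoc)
    then show ?thesis using walk_mod_snoc[of n "x + a" "A @ B" a] by simp
  qed
  finally show ?case by (simp add: add.assoc)
qed

lemma sorted_walk_mod:
  "x + sum_list D < n \<Longrightarrow> sorted (walk_mod n x (D @ [d])) \<and> (\<forall>y \<in> set (walk_mod n x (D @ [d])). x \<le> y)"
  by (induction D arbitrary: x) force+

text \<open>A walk that stays below \<open>n\<close> does not wrap, so its gaps are the differences
  of consecutive points. The final gaps \<open>d\<close> and \<open>d'\<close> leave no trace and
  may differ.\<close>

lemma walk_mod_inj:
  assumes "walk_mod n x (D @ [d]) = walk_mod n x' (D' @ [d'])"
    and "x + sum_list D < n" "x' + sum_list D' < n"
  shows "x = x' \<and> D = D'"
  using assms
proof (induction D arbitrary: x x' D')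
  case Nil
  then have "length ([] @ [d]) = length (D' @ [d'])" by (metis length_walk_mod)
  with Nil show ?case by auto
next
  case (Cons a D)
  then have "length ((a # D) @ [d]) = length (D' @ [d'])" by (metis length_walk_mod)
  then obtain a' D'' where D': "D' = a' # D''"
    by (cases D') auto
  have "x + a = x' + a' \<and> D = D''"
    using Cons by (intro Cons.IH) (auto simp: D')
  moreover have "x = x'" using Cons.prems by (auto simp: D')
  ultimately show ?case by (simp add: D')
qed

lemma sorted_is_walk_mod:
  assumes "sorted (x # s)" "set (x # s) \<subseteq> {..<n}"
  shows "\<exists>D. walk_mod n x (D @ [d]) = x # s \<and> x + sum_list D < n"
  using assms
proof (induction s arbitrary: x)
  case Nil
  then show ?case by (intro exI[of _ "[]"]) auto
next
  case (Cons y s)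
  from Cons.prems have "sorted (y # s)" "set (y # s) \<subseteq> {..<n}" by auto
  from Cons.IH[OF this] obtain D where "walk_mod n y (D @ [d]) = y # s" "y + sum_list D < n"
    by blast
  with Cons.prems show ?case by (intro exI[of _ "(y - x) # D"]) auto
qed

definition rot :: "nat \<Rightarrow> nat \<times> nat list \<Rightarrow> nat \<times> nat list" where
  "rot n p = ((fst p + hd (snd p)) mod n, rotate1 (snd p))"

lemma rot_funpow:
  assumes "x < n"
  shows "(rot n ^^ length A) (x, A @ B) = ((x + sum_list A) mod n, B @ A)"
  using assms
proof (induction A arbitrary: x B)
  case (Cons a A)
  have "(rot n ^^ length (a # A)) (x, (a # A) @ B) = (rot n ^^ length A) ((x + a) mod n, A @ B @ [a])"
    by (simp add: funpow_swap1 rot_def)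
  also have "\<dots> = (((x + a) mod n + sum_list A) mod n, (B @ [a]) @ A)"
    using Cons.prems by (subst Cons.IH) auto
  finally show ?case by (simp add: mod_add_left_eq add.assoc)
qed simp

lemma rot_funpow_length:
  assumes "x < n" "sum_list D = n"
  shows "(rot n ^^ length D) (x, D) = (x, D)"
  using rot_funpow[of x n D "[]"] assms by simp

text \<open>A closed walk of total length \<open>n\<close> passes 0 in exactly one gap. Starting
  right after that gap and putting it last lists the same points in ascending order, which serves as
  a normal form.\<close>

lemma rot_reaches_sorted:
  assumes "x < n" "sum_list D = n"
  obtains k x' D' d where "(rot n ^^ k) (x, D) = (x', D' @ [d])" "x' + sum_list D' < n"
    "mset (walk_mod n x' (D' @ [d])) = mset (walk_mod n x D)" "mset (D' @ [d]) = mset D"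
proof -
  define P where "P i \<longleftrightarrow> x + sum_list (take i D) \<ge> n" for i
  have PD: "P (length D)" and P0: "\<not> P 0" using assms by (auto simp: P_def)
  \<comment> \<open>\<open>k\<close> counts the gaps up to and including the one that reaches
    \<open>n\<close>.\<close>
  define k where "k = (LEAST i. P i)"
  have Pk: "P k" unfolding k_def using PD by (rule LeastI)
  have kD: "k \<le> length D" unfolding k_def using PD by (rule Least_le)
  obtain j where j: "k = Suc j" using Pk P0 by (cases k) auto
  then have nPj: "\<not> P j" using not_less_Least[of j P] by (auto simp: k_def)
  define A a B where "A = take j D" and "a = D ! j" and "B = drop k D"
  have D: "D = (A @ [a]) @ B"
    using kD j by (simp add: A_def a_def B_def id_take_nth_drop)
  have tk: "take k D = A @ [a]"
    using kD j by (simp add: A_def a_def take_Suc_conv_app_nth)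
  have ge: "x + sum_list A + a \<ge> n" and lt: "x + sum_list A < n"
    using Pk nPj tk by (auto simp: P_def A_def)
  have n: "sum_list A + a + sum_list B = n" using assms(2) by (simp add: D)
  have m: "(x + sum_list (A @ [a])) mod n = x + sum_list A + a - n"
  proof -
    have "x + sum_list A + a - n < n" using n assms(1) by linarith
    then show ?thesis using ge by (simp add: le_mod_geq add.assoc)
  qed
  have "(rot n ^^ length (A @ [a])) (x, D) = (x + sum_list A + a - n, (B @ A) @ [a])"
    using rot_funpow[OF assms(1), of "A @ [a]" B] m by (simp add: D)
  moreover have "x + sum_list A + a - n + sum_list (B @ A) < n"
    using n lt ge by simp
  moreover have "mset (walk_mod n (x + sum_list A + a - n) ((B @ A) @ [a])) = mset (walk_mod n x D)"
    using mset_walk_mod_rotate[of "A @ [a]" B n x] assms(2) m by (simp add: D)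
  moreover have "mset ((B @ A) @ [a]) = mset D" by (simp add: D)
  ultimately show ?thesis using that by blast
qed

text \<open>A nontrivial rotation brings another position to the end, and that position would hold a
  second copy of \<open>last D\<close>.\<close>

lemma rotate_last_unique:
  assumes "count (mset D) (last D) = 1" "last (rotate j D) = last D" "D \<noteq> []"
  shows "j mod length D = 0"
proof -
  define i where "i = j mod length D"
  have i: "i < length D" using assms(3) by (simp add: i_def)
  have rj: "rotate j D = drop i D @ take i D"
    by (simp add: i_def rotate_drop_take)
  show ?thesis
  proof (rule ccontr)
    assume "j mod length D \<noteq> 0"
    then have i0: "i \<noteq> 0" by (simp add: i_def)
    have "last D = last (take i D)"
      using assms(2) i0 by (auto simp: rj last_append split: if_splits)
    then have "last D \<in> set (take i D)"
      using i0 assms(3) by (metis last_in_set take_eq_Nil)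
    moreover have "last D \<in> set (drop i D)"
      using i by (metis drop_eq_Nil last_drop last_in_set not_le)
    ultimately have "count (mset (take i D)) (last D) \<ge> 1" "count (mset (drop i D)) (last D) \<ge> 1"
      by (auto simp: Suc_le_eq)
    moreover have "count (mset D) (last D) = count (mset (take i D)) (last D) + count (mset (drop i D)) (last D)"
      by (metis append_take_drop_id count_union mset_append)
    ultimately show False using assms(1) by linarith
  qed
qed

lemma snd_rot_funpow: "snd ((rot n ^^ k) p) = rotate k (snd p)"
  by (induction k) (auto simp: rot_def)

subsection \<open>The gap digraph\<close>

text \<open>
  The function \<open>f\<close> chooses the omitted gap. The assumption \<open>strict_max\<close> makes it possible to
  replace a largest gap by 0, and \<open>escape_zero\<close> to leave the arcs whose omitted gap is 0, where
  this replacement fails.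
\<close>

locale gap_selector =
  fixes t n :: nat and f :: "nat multiset \<Rightarrow> nat"
  assumes t_ge: "t \<ge> 3" and n_ge: "n \<ge> 3"
    and unique: "\<lbrakk>size M = t; sum_mset M = n\<rbrakk> \<Longrightarrow> count M (f M) = 1"
    and strict_max: "\<lbrakk>0 \<in># M; count M a = 1; \<forall>x \<in># M. x \<le> a\<rbrakk> \<Longrightarrow> f M = a"
    and escape_zero: "\<lbrakk>size M = t; sum_mset M = n; f M = 0\<rbrakk>
      \<Longrightarrow> \<exists>K y z. M = add_mset 0 (add_mset (y + z) K) \<and> y > 0 \<and> f (add_mset y (add_mset z K)) = y"
begin

text \<open>
  The arc \<open>(x, ds, w)\<close> stands for the window that starts at \<open>x\<close> and advances by the gaps \<open>ds\<close>
  modulo \<open>n\<close>; the remaining gap \<open>w\<close> closes the circle.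
\<close>

definition gap_arcs :: "(nat \<times> nat list \<times> nat) set" where
  "gap_arcs = {(x, ds, w). x < n \<and> length ds + 1 = t \<and> sum_list ds + w = n \<and> f (add_mset w (mset ds)) = w}"

text \<open>A start and \<open>t - 2\<close> gaps encode a word of \<open>t - 1\<close> points;
  \<open>src\<close> and \<open>tgt\<close> are the prefix and the suffix of the \<open>t\<close>
  points of a window.\<close>

definition src :: "nat \<times> nat list \<times> nat \<Rightarrow> nat \<times> nat list" where
  "src = (\<lambda>(x, ds, w). (x, butlast ds))"

definition tgt :: "nat \<times> nat list \<times> nat \<Rightarrow> nat \<times> nat list" where
  "tgt = (\<lambda>(x, ds, w). ((x + hd ds) mod n, tl ds))"

definition step :: "nat \<times> nat list \<times> nat \<Rightarrow> nat \<times> nat list \<times> nat" where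
  "step = (\<lambda>(x, ds, w). ((x + hd ds) mod n, rotate1 ds, w))"

definition window :: "nat \<times> nat list \<times> nat \<Rightarrow> nat multiset" where
  "window = (\<lambda>(x, ds, w). mset (walk_mod n x (ds @ [w])))"

lemma arcs_iff:
  "(x, ds, w) \<in> gap_arcs \<longleftrightarrow> x < n \<and> length ds + 1 = t \<and> sum_list ds + w = n \<and> f (add_mset w (mset ds)) = w"
  by (simp add: gap_arcs_def)

lemma arcs_nonempty_gaps: "(x, ds, w) \<in> gap_arcs \<Longrightarrow> ds \<noteq> []"
  using t_ge by (auto simp: arcs_iff)

lemma finite_arcs: "finite gap_arcs"
proof (rule finite_subset)
  show "gap_arcs \<subseteq> {..<n} \<times> {ds. set ds \<subseteq> {..n} \<and> length ds = t - 1} \<times> {..n}"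
    by (force simp: gap_arcs_def dest: member_le_sum_list)
  show "finite ({..<n} \<times> {ds. set ds \<subseteq> {..n} \<and> length ds = t - 1} \<times> {..n})"
    by (intro finite_cartesian_product finite_lists_length_eq) auto
qed

lemma step_in_arcs: "e \<in> gap_arcs \<Longrightarrow> step e \<in> gap_arcs"
  by (cases e; cases "fst (snd e)") (auto simp: arcs_iff step_def)

lemma src_step: "e \<in> gap_arcs \<Longrightarrow> src (step e) = tgt e"
  using arcs_nonempty_gaps by (cases e; cases "fst (snd e)") (auto simp: src_def step_def tgt_def)

lemma bij_step: "bij_betw step gap_arcs gap_arcs"
proof -
  have "inj_on step gap_arcs"
  proof (rule inj_onI)
    fix e e' assume e: "e \<in> gap_arcs" "e' \<in> gap_arcs" "step e = step e'"
    obtain x ds w where E: "e = (x, ds, w)" by (cases e)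
    obtain x' ds' w' where E': "e' = (x', ds', w')" by (cases e')
    have "ds = ds'" "w = w'" using e(3) by (auto simp: E E' step_def dest: injD[OF inj_rotate1])
    moreover have "x = x'"
      using e calculation by (intro mod_add_right_cancel[of x "hd ds" n x']) (auto simp: E E' step_def arcs_iff)
    ultimately show "e = e'" by (simp add: E E')
  qed
  then show ?thesis
    using step_in_arcs finite_arcs endo_inj_surj[of gap_arcs step]
    by (simp add: bij_betw_def image_subset_iff)
qed

lemma step_funpow:
  assumes "x < n"
  shows "(step ^^ length A) (x, A @ B, w) = ((x + sum_list A) mod n, B @ A, w)"
proof -
  have "(step ^^ k) (x, ds, w) = (case (rot n ^^ k) (x, ds) of (y, es) \<Rightarrow> (y, es, w))" for k ds
    by (induction k) (auto simp: step_def rot_def split: prod.splits)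
  then show ?thesis by (simp add: rot_funpow[OF assms])
qed

section \<open>Arcs correspond bijectively to \<open>t\<close>-multisets\<close>

text \<open>Closed walks with the same points have the same sorted normal form, hence are rotations
  of each other. Both end in the chosen gap, which occurs only once, so the rotation is
  trivial.\<close>

lemma inj_on_window: "inj_on window gap_arcs"
proof (rule inj_onI)
  fix e e' assume e: "e \<in> gap_arcs" "e' \<in> gap_arcs" "window e = window e'"
  obtain x ds w where E: "e = (x, ds, w)" by (cases e)
  obtain x' ds' w' where E': "e' = (x', ds', w')" by (cases e')
  define D D' where "D = ds @ [w]" and "D' = ds' @ [w']"
  have D: "x < n" "length D = t" "sum_list D = n" "last D = f (mset D)"
    and D': "x' < n" "length D' = t" "sum_list D' = n" "last D' = f (mset D')"
    using e by (auto simp: E E' D_def D'_def arcs_iff)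
  obtain k y C c where k: "(rot n ^^ k) (x, D) = (y, C @ [c])" "y + sum_list C < n"
      "mset (walk_mod n y (C @ [c])) = mset (walk_mod n x D)" "mset (C @ [c]) = mset D"
    using rot_reaches_sorted[OF D(1,3)] .
  obtain k' y' C' c' where k': "(rot n ^^ k') (x', D') = (y', C' @ [c'])" "y' + sum_list C' < n"
      "mset (walk_mod n y' (C' @ [c'])) = mset (walk_mod n x' D')" "mset (C' @ [c']) = mset D'"
    using rot_reaches_sorted[OF D'(1,3)] .
  have "mset (walk_mod n y (C @ [c])) = mset (walk_mod n y' (C' @ [c']))"
    using e(3) k(3) k'(3) by (simp add: E E' D_def D'_def window_def)
  then have "walk_mod n y (C @ [c]) = walk_mod n y' (C' @ [c'])"
    using sorted_walk_mod[OF k(2), of c] sorted_walk_mod[OF k'(2), of c']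
    by (metis properties_for_sort)
  then have yC: "y = y'" "C = C'"
    using walk_mod_inj k(2) k'(2) by blast+
  \<comment> \<open>The points do not show the last gap; the total \<open>n\<close> determines
    it.\<close>
  have "sum_list (C @ [c]) = n" "sum_list (C' @ [c']) = n"
    using k(4) k'(4) D(3) D'(3) by (metis sum_mset_sum_list)+
  then have "c = c'" using yC by simp
  then have eq: "(rot n ^^ k) (x, D) = (rot n ^^ k') (x', D')" and mD: "mset D = mset D'"
    using k k' yC by auto
  have per: "((rot n ^^ t) ^^ i) (x', D') = (x', D')" for i
    using rot_funpow_length[OF D'(1,3)] D'(2) by (induction i) auto
  \<comment> \<open>Since \<open>t\<close> rotations act as the identity,
    \<open>k' * (t - 1)\<close> further rotations undo \<open>k'\<close> of them.\<close>
  define m where "m = k' * (t - 1) + k"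
  have "(rot n ^^ m) (x, D) = (rot n ^^ (k' * (t - 1) + k')) (x', D')"
    unfolding m_def funpow_add comp_def eq ..
  also have "k' * (t - 1) + k' = t * k'" using t_ge by (cases t) auto
  also have "(rot n ^^ (t * k')) (x', D') = (x', D')" using per by (simp add: funpow_mult)
  finally have m: "(rot n ^^ m) (x, D) = (x', D')" .
  then have "D' = rotate m D" using snd_rot_funpow[of m n "(x, D)"] by simp
  moreover have "count (mset D) (last D) = 1"
    using unique[of "mset D"] D by (simp add: sum_mset_sum_list)
  moreover have "last D' = last D" using D(4) D'(4) mD by simp
  moreover have "D \<noteq> []" using D(2) t_ge by auto
  ultimately have "m mod t = 0"
    using rotate_last_unique[of D m] D(2) by simp
  then obtain q where "m = t * q" by auto
  moreover have "((rot n ^^ t) ^^ i) (x, D) = (x, D)" for i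
    using rot_funpow_length[OF D(1,3)] D(2) by (induction i) auto
  ultimately have "(x, D) = (x', D')"
    using m by (simp add: funpow_mult)
  then show "e = e'" by (simp add: E E' D_def D'_def)
qed

text \<open>The differences of the sorted elements, closed up to total \<open>n\<close>, give a
  closed walk; rotating the chosen gap to the end turns it into an arc.\<close>

lemma window_surj:
  assumes "size M = t" "set_mset M \<subseteq> {..<n}"
  obtains e where "e \<in> gap_arcs" "window e = M"
proof -
  have "M \<noteq> {#}" using assms(1) t_ge by auto
  then obtain a s where s: "sorted_list_of_multiset M = a # s"
    by (metis list.exhaust mset.simps(1) mset_sorted_list_of_multiset)
  have M: "mset (a # s) = M" by (metis mset_sorted_list_of_multiset s)
  have "sorted (a # s)" by (metis s sorted_sorted_list_of_multiset)
  moreover have "set (a # s) \<subseteq> {..<n}" using assms(2) M by (metis set_mset_mset)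
  \<comment> \<open>The final gap 0 is a placeholder, replaced below by an arbitrary
    \<open>d\<close> and then by the gap that closes the circle.\<close>
  ultimately obtain B where "walk_mod n a (B @ [0]) = a # s" "a + sum_list B < n"
    using sorted_is_walk_mod[of a s n 0] by blast
  then have B: "walk_mod n a (B @ [d]) = a # s" "a + sum_list B < n" for d
    by (simp_all add: walk_mod_snoc)
  define D where "D = B @ [n - sum_list B]"
  have D: "sum_list D = n" "mset (walk_mod n a D) = M" using B M by (auto simp: D_def)
  have "length D = t" using assms(1) D(2) by (metis length_walk_mod size_mset)
  then have "count (mset D) (f (mset D)) = 1"
    using unique[of "mset D"] D(1) by (simp add: sum_mset_sum_list)
  then have "f (mset D) \<in> set D"
    by (metis count_eq_zero_iff set_mset_mset zero_neq_one)
  then obtain P Q w where w: "f (mset D) = w" and "D = P @ w # Q" by (metis split_list)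
  then have PQ: "D = (P @ [w]) @ Q" by simp
  define e where "e = ((a + sum_list (P @ [w])) mod n, Q @ P, w)"
  have "e \<in> gap_arcs"
  proof -
    have "add_mset w (mset (Q @ P)) = mset D" by (simp add: PQ)
    moreover have "length (Q @ P) + 1 = t" "sum_list (Q @ P) + w = n"
      using D(1) \<open>length D = t\<close> by (simp_all add: PQ)
    ultimately show ?thesis
      using n_ge w by (simp add: e_def arcs_iff)
  qed
  moreover have "window e = M"
    using mset_walk_mod_rotate[of "P @ [w]" Q n a] D PQ by (simp add: e_def window_def)
  ultimately show ?thesis using that by blast
qed

lemma card_arcs: "card gap_arcs = (n + t - 1) choose t"
proof -
  have "window ` gap_arcs = multisets_of_size {..<n} t"
  proof
    show "window ` gap_arcs \<subseteq> multisets_of_size {..<n} t"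
      using set_walk_mod[of n] n_ge by (fastforce simp: multisets_of_size_def window_def arcs_iff)
    show "multisets_of_size {..<n} t \<subseteq> window ` gap_arcs"
      using window_surj by (auto simp: multisets_of_size_def image_iff) metis
  qed
  then have "card gap_arcs = card (multisets_of_size {..<n} t)"
    using card_image[OF inj_on_window] by simp
  then show ?thesis by (simp add: card_multisets_of_size)
qed

section \<open>Connectivity of the gap digraph\<close>

context
  fixes Q :: "nat \<times> nat list \<times> nat \<Rightarrow> bool"
  assumes Q_step: "\<And>e. e \<in> gap_arcs \<Longrightarrow> Q (step e) \<longleftrightarrow> Q e"
    and Q_src: "\<And>e e'. \<lbrakk>e \<in> gap_arcs; e' \<in> gap_arcs; src e = src e'\<rbrakk> \<Longrightarrow> Q e \<longleftrightarrow> Q e'"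
    and Q_base: "Q (0, replicate (t - 1) 0, n)"
begin

lemma Q_rotate:
  assumes "(x, A @ B, w) \<in> gap_arcs"
  shows "Q ((x + sum_list A) mod n, B @ A, w) \<longleftrightarrow> Q (x, A @ B, w)"
proof -
  have "(step ^^ k) (x, A @ B, w) \<in> gap_arcs \<and> Q ((step ^^ k) (x, A @ B, w)) = Q (x, A @ B, w)" for k
    by (induction k) (use assms step_in_arcs Q_step in auto)
  from this[of "length A"] show ?thesis
    using assms by (simp add: step_funpow arcs_iff)
qed

text \<open>Rotation brings the gap \<open>a\<close> to the last listed place, which
  \<open>src\<close> ignores. There \<open>a\<close> and \<open>w\<close> may be traded for
  \<open>a'\<close> and \<open>w'\<close> of equal sum, provided that \<open>w'\<close> is the
  selected gap. Rotating on moves the base point, hence the hypothesis for all starts.\<close>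

lemma Q_replace:
  assumes e: "(x, A @ a # B, w) \<in> gap_arcs"
    and e': "a' + w' = a + w" "f (add_mset w' (mset (A @ a' # B))) = w'"
    and Q: "\<And>x. x < n \<Longrightarrow> Q (x, A @ a' # B, w')"
  shows "Q (x, A @ a # B, w)"
proof -
  define y where "y = (x + sum_list (A @ [a])) mod n"
  have y: "y < n" using n_ge by (simp add: y_def)
  have 1: "(y, (B @ A) @ [a], w) \<in> gap_arcs" "(y, (B @ A) @ [a'], w') \<in> gap_arcs"
    using e e' y by (auto simp: arcs_iff add.commute)
  have "Q (x, A @ a # B, w) \<longleftrightarrow> Q (y, (B @ A) @ [a], w)"
    using Q_rotate[of x "A @ [a]" B w] e by (simp add: y_def)
  also have "\<dots> \<longleftrightarrow> Q (y, (B @ A) @ [a'], w')"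
    using 1 by (intro Q_src) (simp_all add: src_def butlast_append)
  also have "\<dots> \<longleftrightarrow> Q ((y + sum_list B) mod n, (A @ [a']) @ B, w')"
    using Q_rotate[of y B "A @ [a']" w'] 1 by simp
  finally show ?thesis using Q[of "(y + sum_list B) mod n"] n_ge by simp
qed

text \<open>Changing the last 0 to 1 keeps the source, a full rotation of the listed gaps then
  advances the start by 1, and changing 1 back to 0 yields the constant window at the next point. As
  \<open>n \<ge> 3\<close>, the omitted gap \<open>n - 1\<close> is still the strict
  maximum.\<close>

lemma Q_zeros: "x < n \<Longrightarrow> Q (x, replicate (t - 1) 0, n)"
proof (induction x)
  case 0
  then show ?case using Q_base by simp
next
  case (Suc x)
  define Z where "Z = replicate (t - 2) (0::nat)"
  have "t - 1 = Suc (t - 2)" using t_ge by simp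
  then have r: "replicate (t - 1) 0 = Z @ [0]"
    by (simp add: Z_def replicate_append_same)
  have Z: "length Z = t - 2" "sum_list Z = 0" "0 \<in> set Z" "\<forall>z \<in> set Z. z = 0"
    using t_ge by (auto simp: Z_def)
  have cZ: "count (mset Z) (n - Suc 0) = 0" "count (mset Z) n = 0"
    using Z(4) n_ge by (auto simp: count_eq_zero_iff)
  have arc0: "(y, Z @ [0], n) \<in> gap_arcs" if "y < n" for y
    using that t_ge n_ge Z cZ unfolding arcs_iff
    by (intro conjI strict_max) auto
  have arc1: "(y, Z @ [1], n - 1) \<in> gap_arcs" if "y < n" for y
    using that t_ge n_ge Z cZ unfolding arcs_iff
    by (intro conjI strict_max) auto
  have same: "Q (y, Z @ [0], n) \<longleftrightarrow> Q (y, Z @ [1], n - 1)" if "y < n" for y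
    using arc0[OF that] arc1[OF that] by (intro Q_src) (auto simp: src_def)
  have "Q (x, Z @ [1], n - 1)" using Suc same r by simp
  then have "Q ((x + sum_list (Z @ [1])) mod n, Z @ [1], n - 1)"
    using Q_rotate[of x "Z @ [1]" "[]" "n - 1"] arc1[of x] Suc.prems by simp
  then have "Q (Suc x, Z @ [1], n - 1)" using Z Suc.prems by simp
  then show ?case using same Suc.prems r by simp
qed

text \<open>Setting a largest listed gap \<open>m\<close> to 0 makes the omitted gap
  \<open>w + m\<close>, which exceeds every listed gap because \<open>w > 0\<close>, so it is
  selected. The listed sum drops until all listed gaps are 0.\<close>

lemma Q_positive:
  assumes "(x, ds, w) \<in> gap_arcs" "w > 0"
  shows "Q (x, ds, w)"
  using assms
proof (induction "sum_list ds" arbitrary: x ds w rule: less_induct)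
  case less
  have ds: "ds \<noteq> []" using less.prems arcs_nonempty_gaps by blast
  define m where "m = Max (set ds)"
  have m: "m \<in> set ds" and le: "\<And>d. d \<in> set ds \<Longrightarrow> d \<le> m" using ds by (auto simp: m_def)
  show ?case
  proof (cases "m = 0")
    case True
    then have "ds = replicate (length ds) 0" using le by (intro replicate_length_same[symmetric]) auto
    moreover from this have "w = n" using less.prems by (metis arcs_iff sum_list_replicate mult_0_right add_0)
    ultimately show ?thesis using Q_zeros[of x] less.prems by (metis arcs_iff add_diff_cancel_right')
  next
    case False
    from m obtain A B where AB: "ds = A @ m # B" by (meson split_list)
    have f: "f (add_mset (w + m) (mset (A @ 0 # B))) = w + m"
    proof (rule strict_max)
      have "w + m \<notin> set A" "w + m \<notin> set B" using le[of "w + m"] less.prems by (auto simp: AB)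
      then show "count (add_mset (w + m) (mset (A @ 0 # B))) (w + m) = 1"
        using False by (auto simp: count_eq_zero_iff)
      show "\<forall>x \<in># add_mset (w + m) (mset (A @ 0 # B)). x \<le> w + m"
        using le by (auto simp: AB intro: trans_le_add2)
    qed simp
    have "Q (y, A @ 0 # B, w + m)" if "y < n" for y
      using less.prems f that False by (intro less.hyps) (auto simp: AB arcs_iff)
    then show ?thesis
      unfolding AB using less.prems f AB by (intro Q_replace[of x A m B w 0 "w + m"]) auto
  qed
qed

text \<open>If the omitted gap is 0, a listed gap \<open>y + z\<close> is split into a listed
  \<open>z\<close> and an omitted \<open>y > 0\<close>, which leads back to the positive
  case.\<close>

lemma Q_all:
  assumes "e \<in> gap_arcs"
  shows "Q e"
proof -
  obtain x ds w where e: "e = (x, ds, w)" by (cases e)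
  note arc = assms[unfolded e]
  show ?thesis
  proof (cases "w = 0")
    case True
    with arc have "size (add_mset 0 (mset ds)) = t" "sum_mset (add_mset 0 (mset ds)) = n"
        "f (add_mset 0 (mset ds)) = 0"
      by (auto simp: arcs_iff sum_mset_sum_list)
    from escape_zero[OF this] obtain K y z where
      K: "mset ds = add_mset (y + z) K" "y > 0" "f (add_mset y (add_mset z K)) = y"
      by auto
    then have "y + z \<in> set ds" by (metis set_mset_mset union_single_eq_member)
    then obtain A B where AB: "ds = A @ (y + z) # B" by (meson split_list)
    with K have "K = mset A + mset B" by simp
    with K have f: "f (add_mset y (mset (A @ z # B))) = y" by simp
    have "Q (x, A @ z # B, y)" if "x < n" for x
      using that f arc K(2) True by (intro Q_positive) (auto simp: AB arcs_iff)
    then show ?thesis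
      unfolding e AB using arc f True AB by (intro Q_replace[of x A "y + z" B w z y]) auto
  next
    case False
    with Q_positive arc show ?thesis by (simp add: e)
  qed
qed

end

lemma base_in_arcs: "(0, replicate (t - 1) 0, n) \<in> gap_arcs"
  using t_ge n_ge unfolding arcs_iff by (intro conjI strict_max) auto

section \<open>Reading the cycle off the Eulerian circuit\<close>

text \<open>The starts of \<open>t\<close> successive arcs are the points of the first arc's window,
  so it suffices to record the starts.\<close>

lemma overlap_fst:
  assumes L: "length p > 0"
    and p: "set p \<subseteq> gap_arcs"
    and succ: "\<And>i. i < length p \<Longrightarrow> src (p ! (Suc i mod length p)) = tgt (p ! i)"
    and j: "j < t"
  shows "fst (p ! ((i + j) mod length p)) =
    (fst (p ! (i mod length p)) + sum_list (take j (fst (snd (p ! (i mod length p)))))) mod n"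
  using j
proof (induction j arbitrary: i)
  case 0
  have "p ! (i mod length p) \<in> gap_arcs"
    using p L by (meson mod_less_divisor nth_mem subsetD)
  then show ?case by (cases "p ! (i mod length p)") (simp add: arcs_iff)
next
  case (Suc j)
  obtain x ds w where e: "p ! (i mod length p) = (x, ds, w)" by (cases "p ! (i mod length p)")
  obtain x' ds' w' where e': "p ! (Suc i mod length p) = (x', ds', w')"
    by (cases "p ! (Suc i mod length p)")
  have arc: "(x, ds, w) \<in> gap_arcs" "(x', ds', w') \<in> gap_arcs"
    using p L unfolding e[symmetric] e'[symmetric] by (meson mod_less_divisor nth_mem subsetD)+
  have "src (p ! (Suc i mod length p)) = tgt (p ! (i mod length p))"
    using succ[of "i mod length p"] L by (simp add: mod_Suc_eq)
  then have x': "x' = (x + hd ds) mod n" and ds': "butlast ds' = tl ds"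
    by (auto simp: e e' src_def tgt_def)
  have len: "length ds' = t - 1" "length ds = t - 1" using arc by (auto simp: arcs_iff)
  \<comment> \<open>Successive arcs agree on \<open>t - 2\<close> gaps, and \<open>Suc j < t\<close>
    keeps the prefix inside this overlap.\<close>
  have "take j ds' = take j (tl ds)"
    using Suc.prems len unfolding ds'[symmetric] by (simp add: take_butlast)
  then have "hd ds + sum_list (take j ds') = sum_list (take (Suc j) ds)"
    using arcs_nonempty_gaps[OF arc(1)] by (cases ds) auto
  then have "(x' + sum_list (take j ds')) mod n = (x + sum_list (take (Suc j) ds)) mod n"
    by (simp add: x' mod_add_left_eq add.assoc)
  then show ?case using Suc.IH[of "Suc i"] Suc.prems by (simp add: e e')
qed

theorem Mcycle_exists: "\<exists>xs. is_Mcycle t n xs"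
proof -
  obtain p where p: "distinct p" "set p = gap_arcs"
      "\<And>i. i < length p \<Longrightarrow> src (p ! (Suc i mod length p)) = tgt (p ! i)"
    by (rule eulerian_circuit_if_successor_bij[OF finite_arcs base_in_arcs bij_step, of src tgt])
      (use src_step Q_all in \<open>blast+\<close>)
  have L: "length p > 0" using p(2) base_in_arcs by (cases p) auto
  \<comment> \<open>\<open>Suc\<close> shifts the residues \<open>0..n-1\<close> to the entries
    \<open>1..n\<close>.\<close>
  define xs where "xs = map (\<lambda>e. Suc (fst e)) p"
  have win: "cyclic_window t xs i = image_mset Suc (window (p ! i))" if "i < length p" for i
  proof -
    obtain x ds w where e: "p ! i = (x, ds, w)" by (cases "p ! i")
    have "(x, ds, w) \<in> gap_arcs" using that p(2) e by (metis nth_mem)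
    then have len: "length (ds @ [w]) = t" by (simp add: arcs_iff)
    have "map (\<lambda>j. xs ! ((i + j) mod length xs)) [0..<t] = map Suc (walk_mod n x (ds @ [w]))"
    proof (rule nth_equalityI)
      fix j assume "j < length (map (\<lambda>j. xs ! ((i + j) mod length xs)) [0..<t])"
      then have j: "j < t" by simp
      have "xs ! ((i + j) mod length xs) = Suc (fst (p ! ((i + j) mod length p)))"
        using L by (simp add: xs_def)
      also have "fst (p ! ((i + j) mod length p)) = (x + sum_list (take j ds)) mod n"
        using overlap_fst[of p j i] L p j that e by simp
      also have "\<dots> = walk_mod n x (ds @ [w]) ! j"
        using len j by (simp add: nth_walk_mod)
      finally show "map (\<lambda>j. xs ! ((i + j) mod length xs)) [0..<t] ! j = map Suc (walk_mod n x (ds @ [w])) ! j"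
        using len j by simp
    qed (use len in simp)
    then show ?thesis by (simp add: cyclic_window_def window_def e)
  qed
  have "length xs = (n + t - 1) choose t"
    using card_arcs p by (simp add: xs_def flip: distinct_card)
  moreover have "set xs \<subseteq> {1..n}"
    using p(2) by (auto simp: xs_def arcs_iff Suc_le_eq)
  moreover have "inj_on (cyclic_window t xs) {..<length xs}"
  proof (rule inj_onI)
    fix i j assume ij: "i \<in> {..<length xs}" "j \<in> {..<length xs}" "cyclic_window t xs i = cyclic_window t xs j"
    then have "image_mset Suc (window (p ! i)) = image_mset Suc (window (p ! j))"
      using win by (simp add: xs_def)
    then have "window (p ! i) = window (p ! j)"
      using multiset.inj_map[of Suc] by (auto dest: injD)
    moreover have "p ! i \<in> gap_arcs" "p ! j \<in> gap_arcs"
      using ij p(2) nth_mem by (auto simp: xs_def)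
    ultimately have "p ! i = p ! j"
      using inj_on_window by (simp add: inj_onD)
    then show "i = j" using p(1) ij by (simp add: nth_eq_iff_index_eq xs_def)
  qed
  ultimately show ?thesis unfolding is_Mcycle_def by blast
qed

end

subsection \<open>Choosing the omitted gap\<close>

text \<open>These are the gap multisets that admit no choice. Their multiplicities form a partition
  of the size into parts at least 2.\<close>

definition repeated :: "'a multiset \<Rightarrow> bool" where
  "repeated M \<longleftrightarrow> (\<forall>x \<in># M. count M x \<ge> 2)"

lemma repeated_split:
  assumes "repeated M" "M \<noteq> {#}"
  obtains a k N where "M = replicate_mset k a + N" "k \<ge> 2" "a \<notin># N" "repeated N" "size M = k + size N"
proof -
  obtain a where a: "a \<in># M" using assms(2) by blast
  define N where "N = {#x \<in># M. x \<noteq> a#}"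
  have M: "M = replicate_mset (count M a) a + N"
    unfolding N_def using multiset_partition[of M "\<lambda>x. x = a"] by (simp add: filter_eq_replicate_mset)
  have "repeated N"
    using assms(1) by (auto simp: repeated_def N_def)
  moreover have "a \<notin># N" by (simp add: N_def)
  moreover have "count M a \<ge> 2" using a assms(1) by (simp add: repeated_def)
  moreover have "size M = count M a + size N" by (subst M) simp
  ultimately show ?thesis using that M by blast
qed

lemma repeated_size_ne_1: "repeated M \<Longrightarrow> size M \<noteq> 1"
proof
  assume M: "repeated M" "size M = 1"
  then obtain a where "M = {#a#}" using size_1_singleton_mset by blast
  with M(1) show False by (simp add: repeated_def)
qed

lemma repeated_size_2:
  assumes "repeated M" "size M = 2"
  obtains a where "M = replicate_mset 2 a"
proof -
  have "M \<noteq> {#}" using assms by auto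
  then obtain a k N where "M = replicate_mset k a + N" "k \<ge> 2" "size M = k + size N"
    using repeated_split assms(1) by metis
  with assms have "k = 2" "size N = 0" by linarith+
  with \<open>M = _\<close> that show ?thesis by simp
qed

lemma repeated_size_3:
  assumes "repeated M" "size M = 3"
  obtains a where "M = replicate_mset 3 a"
proof -
  have "M \<noteq> {#}" using assms by auto
  then obtain a k N where *: "M = replicate_mset k a + N" "k \<ge> 2" "size M = k + size N" "repeated N"
    using repeated_split assms(1) by metis
  moreover have "size N \<noteq> 1" using repeated_size_ne_1[OF *(4)] .
  ultimately have "k = 3" "size N = 0" using assms by linarith+
  with * that show ?thesis by simp
qed

lemma repeated_size_4_even:
  fixes M :: "nat multiset"
  assumes "repeated M" "size M = 4"
  shows "even (sum_mset M)"
proof -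
  have "M \<noteq> {#}" using assms by auto
  then obtain a k N where *: "M = replicate_mset k a + N" "k \<ge> 2" "size M = k + size N" "repeated N"
    using repeated_split assms(1) by metis
  moreover have "size N \<noteq> 1" using repeated_size_ne_1[OF *(4)] .
  ultimately consider "k = 4" "size N = 0" | "k = 2" "size N = 2"
    using assms by linarith
  then show ?thesis
  proof cases
    case 2
    then obtain b where "N = replicate_mset 2 b" using repeated_size_2 * by metis
    with 2 * show ?thesis by (simp add: sum_mset_replicate_mset)
  qed (simp add: * sum_mset_replicate_mset)
qed

text \<open>The partitions of 5 without a part 1 are 5 and 3 + 2. This size arises for
  \<open>t = 6\<close> once a single gap 0 has been removed.\<close>

lemma repeated_size_5:
  assumes "repeated M" "size M = 5"
  obtains a where "M = replicate_mset 5 a"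
  | a b where "M = replicate_mset 3 a + replicate_mset 2 b" "a \<noteq> b"
proof -
  have "M \<noteq> {#}" using assms by auto
  then obtain a k N where *: "M = replicate_mset k a + N" "k \<ge> 2" "size M = k + size N" "repeated N" "a \<notin># N"
    using repeated_split assms(1) by metis
  moreover have "size N \<noteq> 1" using repeated_size_ne_1[OF *(4)] .
  ultimately consider "k = 5" "size N = 0" | "k = 3" "size N = 2" | "k = 2" "size N = 3"
    using assms by linarith
  then show ?thesis
  proof cases
    case 2
    then obtain b where "N = replicate_mset 2 b" using repeated_size_2 * by metis
    with 2 * that(2)[of a b] show ?thesis by auto
  next
    case 3
    then obtain b where "N = replicate_mset 3 b" using repeated_size_3 * by metis
    with 3 * that(2)[of b a] show ?thesis by (auto simp: add.commute)
  qed (use * that in auto)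
qed

text \<open>The partitions of 6 without a part 1 are 6, 4 + 2, 2 + 2 + 2 and 3 + 3; in each, all
  parts share the factor 2 or 3.\<close>

lemma repeated_size_6:
  fixes M :: "nat multiset"
  assumes "repeated M" "size M = 6"
  shows "2 dvd sum_mset M \<or> 3 dvd sum_mset M"
proof -
  have "M \<noteq> {#}" using assms by auto
  then obtain a k N where *: "M = replicate_mset k a + N" "k \<ge> 2" "size M = k + size N" "repeated N"
    using repeated_split assms(1) by metis
  moreover have "size N \<noteq> 1" using repeated_size_ne_1[OF *(4)] .
  ultimately consider "k = 6" "size N = 0" | "k = 4" "size N = 2" | "k = 3" "size N = 3" | "k = 2" "size N = 4"
    using assms by linarith
  then show ?thesis
  proof cases
    case 2
    then obtain b where "N = replicate_mset 2 b" using repeated_size_2 * by metis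
    with 2 * show ?thesis by (simp add: sum_mset_replicate_mset)
  next
    case 3
    then obtain b where "N = replicate_mset 3 b" using repeated_size_3 * by metis
    with 3 * show ?thesis by (simp add: sum_mset_replicate_mset)
  next
    case 4
    then show ?thesis using * repeated_size_4_even[of N] by (simp add: sum_mset_replicate_mset)
  qed (simp add: * sum_mset_replicate_mset)
qed

text \<open>
  The largest gap is needed for \<open>strict_max\<close>. Always taking the largest gap would violate
  \<open>escape_zero\<close> at \<open>{0, 1, 1, 1, b, b}\<close>, hence the smallest one if \<open>M\<close> does not contain 0.
\<close>

definition sel :: "nat multiset \<Rightarrow> nat" where
  "sel M = (if 0 \<in># M then Max {x. count M x = 1} else Min {x. count M x = 1})"

section \<open>Properties of the selected gap\<close>

lemma finite_singletons: "finite {x. count M x = 1}"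
  by (rule finite_subset[of _ "set_mset M"]) (auto simp: count_inI)

lemma count_sel:
  assumes "\<not> repeated M"
  shows "count M (sel M) = 1"
proof -
  obtain x where "x \<in># M" "count M x < 2"
    using assms by (auto simp: repeated_def not_le)
  moreover have "count M x > 0" using calculation by simp
  ultimately have "count M x = 1" by linarith
  then have "{x. count M x = 1} \<noteq> {}" by blast
  from Max_in[OF finite_singletons this] Min_in[OF finite_singletons this]
  show ?thesis by (simp add: sel_def)
qed

lemma sel_eq_Max:
  assumes "0 \<in># M" "count M a = 1" "\<forall>x \<in># M. x \<le> a"
  shows "sel M = a"
proof -
  have "Max {x. count M x = 1} = a"
    using assms(2,3) finite_singletons[of M] by (intro Max_eqI) (auto simp: count_inI)
  then show ?thesis using assms(1) by (simp add: sel_def)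
qed

lemma sel_eq_Min:
  assumes "0 \<notin># M" "count M a = 1" "\<And>x. \<lbrakk>0 < x; x < a\<rbrakk> \<Longrightarrow> count M x \<noteq> 1"
  shows "sel M = a"
proof -
  have "Min {x. count M x = 1} = a"
  proof (rule Min_eqI[OF finite_singletons])
    fix y assume y: "y \<in> {x. count M x = 1}"
    then have "y \<noteq> 0" using assms(1) by (metis count_inI mem_Collect_eq zero_neq_one)
    then show "a \<le> y" using assms(3)[of y] y by force
  qed (use assms in simp)
  then show ?thesis using assms(1) by (simp add: sel_def)
qed

text \<open>A selected 0 belongs to \<open>M\<close>, so it is the largest value of multiplicity
  one, and every positive value is repeated.\<close>

lemma sel_eq_0:
  assumes "\<not> repeated M" "sel M = 0"
  obtains N where "M = add_mset 0 N" "repeated N" "0 \<notin># N"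
proof -
  have c: "count M 0 = 1" using count_sel[OF assms(1)] assms(2) by simp
  then have "0 \<in># M" by (metis count_inI zero_neq_one)
  then obtain N where N: "M = add_mset 0 N" by (meson mset_add)
  have "0 \<notin># N" using c N by (simp add: not_in_iff)
  moreover have "count N x \<ge> 2" if x: "x \<in># N" for x
  proof (rule ccontr)
    assume "\<not> count N x \<ge> 2"
    moreover have "x \<noteq> 0" using x \<open>0 \<notin># N\<close> by metis
    moreover have "count N x > 0" using x by simp
    moreover have "count M x = count N x" using N \<open>x \<noteq> 0\<close> by simp
    ultimately have "count M x = 1" by linarith
    then have "x \<le> Max {x. count M x = 1}" using finite_singletons[of M] by (intro Max_ge) auto
    then show False using \<open>0 \<in># M\<close> assms(2) \<open>x \<noteq> 0\<close> by (simp add: sel_def)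
  qed
  ultimately show ?thesis using that N by (auto simp: repeated_def)
qed

text \<open>What depends on \<open>t\<close> and \<open>n\<close> is isolated here:
  \<open>nr\<close> guarantees that a choice exists, and \<open>esc\<close> asks for a suitable
  split of what remains after removing a selected 0.\<close>

lemma gap_selector_sel:
  assumes "t \<ge> 3" "n \<ge> 3"
    and nr: "\<And>M. \<lbrakk>size M = t; sum_mset M = n\<rbrakk> \<Longrightarrow> \<not> repeated M"
    and esc: "\<And>N. \<lbrakk>size N = t - 1; sum_mset N = n; repeated N; 0 \<notin># N\<rbrakk> \<Longrightarrow>
      \<exists>K y z. N = add_mset (y + z) K \<and> y > 0 \<and> sel (add_mset y (add_mset z K)) = y"
  shows "gap_selector t n sel"
proof
  show "count M (sel M) = 1" if "size M = t" "sum_mset M = n" for M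
    using nr that count_sel by blast
  show "\<exists>K y z. M = add_mset 0 (add_mset (y + z) K) \<and> 0 < y \<and> sel (add_mset y (add_mset z K)) = y"
    if M: "size M = t" "sum_mset M = n" "sel M = 0" for M
  proof -
    obtain N where "M = add_mset 0 N" "repeated N" "0 \<notin># N"
      using sel_eq_0 nr M by metis
    with esc[of N] M show ?thesis by auto
  qed
qed (use assms sel_eq_Max in auto)

section \<open>The cases \<open>t = 3\<close>, \<open>t = 4\<close> and \<open>t = 6\<close>\<close>

lemma gap_selector_3:
  assumes "n \<ge> 5" "gcd n 3 = 1"
  shows "gap_selector 3 n sel"
proof (rule gap_selector_sel)
  show "\<not> repeated M" if M: "size M = 3" "sum_mset M = n" for M
  proof
    assume "repeated M"
    then obtain a where "M = replicate_mset 3 a" using repeated_size_3 M by metis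
    with M have "n = 3 * a" by (simp add: sum_mset_replicate_mset)
    with assms(2) show False by simp
  qed
next
  fix N assume N: "size N = 3 - 1" "sum_mset N = n" "repeated N" "0 \<notin># N"
  then obtain a where a: "N = replicate_mset 2 a" using repeated_size_2[of N] by auto
  \<comment> \<open>This makes 1 and \<open>a - 1\<close> distinct in the split of \<open>a\<close>,
    so 1 occurs once and is selected; \<open>a = 2\<close> would give 1 twice.\<close>
  with N assms have "a \<ge> 3" by (simp add: sum_mset_replicate_mset)
  then show "\<exists>K y z. N = add_mset (y + z) K \<and> y > 0 \<and> sel (add_mset y (add_mset z K)) = y"
    by (intro exI[of _ "{#a#}"] exI[of _ 1] exI[of _ "a - 1"] conjI sel_eq_Min)
      (auto simp: a numeral_2_eq_2)
qed (use assms in auto)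

lemma gap_selector_4:
  assumes "n \<ge> 5" "gcd n 4 = 1"
  shows "gap_selector 4 n sel"
proof (rule gap_selector_sel)
  have "odd n" using assms(2) by (metis dvd_triv_left even_numeral gcd_greatest odd_one numeral_Bit0 mult_2)
  then show "\<not> repeated M" if "size M = 4" "sum_mset M = n" for M
    using repeated_size_4_even that by blast
  fix N assume N: "size N = 4 - 1" "sum_mset N = n" "repeated N" "0 \<notin># N"
  then obtain a where a: "N = replicate_mset 3 a" using repeated_size_3[of N] by auto
  \<comment> \<open>The value \<open>a = 2\<close> would make \<open>n\<close> even, so
    \<open>a \<ge> 3\<close> and 1 can again be split off.\<close>
  with N have "n = 3 * a" by (simp add: sum_mset_replicate_mset)
  with \<open>odd n\<close> assms have "a \<ge> 3" by (cases "a = 2") auto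
  then show "\<exists>K y z. N = add_mset (y + z) K \<and> y > 0 \<and> sel (add_mset y (add_mset z K)) = y"
    by (intro exI[of _ "{#a, a#}"] exI[of _ 1] exI[of _ "a - 1"] conjI sel_eq_Min)
      (auto simp: a numeral_3_eq_3)
qed (use assms in auto)

lemma gap_selector_6:
  assumes "n \<ge> 11" "gcd n 6 = 1"
  shows "gap_selector 6 n sel"
proof (rule gap_selector_sel)
  have n2: "\<not> 2 dvd n"
  proof
    assume "2 dvd n"
    then have "2 dvd gcd n 6" by simp
    then show False using assms(2) by simp
  qed
  have n3: "\<not> 3 dvd n"
  proof
    assume "3 dvd n"
    then have "3 dvd gcd n 6" by simp
    then show False using assms(2) by simp
  qed
  show "\<not> repeated M" if "size M = 6" "sum_mset M = n" for M
    using repeated_size_6 n2 n3 that by blast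
  fix N assume N: "size N = 6 - 1" "sum_mset N = n" "repeated N" "0 \<notin># N"
  have "\<exists>K y z. N = add_mset (y + z) K \<and> y > 0 \<and> sel (add_mset y (add_mset z K)) = y"
    if N': "N = replicate_mset 5 a" for a
  proof -
    have "a \<ge> 3" using assms N N' by (simp add: sum_mset_replicate_mset)
    then show ?thesis
      by (intro exI[of _ "{#a, a, a, a#}"] exI[of _ 1] exI[of _ "a - 1"] conjI sel_eq_Min)
        (auto simp: N' eval_nat_numeral)
  qed
  moreover have "\<exists>K y z. N = add_mset (y + z) K \<and> y > 0 \<and> sel (add_mset y (add_mset z K)) = y"
    if N': "N = replicate_mset 3 a + replicate_mset 2 b" and ab: "a \<noteq> b" for a b
  proof -
    have n: "n = 3 * a + 2 * b" using N N' by (simp add: sum_mset_replicate_mset)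
    have pos: "a > 0" "b > 0" using N(4) N' by auto
    have "odd a" using n n2 by auto
    \<comment> \<open>In each case the part \<open>y\<close> split off becomes the smallest value of
      multiplicity one: 1 if no gap is 1 yet, otherwise 2, and 3 where splitting 4 would give 2
      twice. For \<open>a = 1\<close>, \<open>n \<ge> 11\<close> forces
      \<open>b \<ge> 4\<close>.\<close>
    then consider "a \<ge> 3" "b \<noteq> 1" | "a \<ge> 3" "b = 1" | "a = 1" "b = 4" | "a = 1" "b \<ge> 5"
      using pos n assms(1) by (cases "a = 2"; cases "a = 1"; cases "b = 4"; force)
    then show ?thesis
    proof cases
      case 1
      then show ?thesis using ab pos
        by (intro exI[of _ "{#a, a, b, b#}"] exI[of _ 1] exI[of _ "a - 1"] conjI sel_eq_Min)
          (auto simp: N' eval_nat_numeral)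
    next
      case 2
      moreover have "a \<noteq> 4" using \<open>odd a\<close> by auto
      ultimately show ?thesis
        by (intro exI[of _ "{#a, a, 1, 1#}"] exI[of _ 2] exI[of _ "a - 2"] conjI sel_eq_Min)
          (auto simp: N' eval_nat_numeral less_Suc_eq)
    next
      case 3
      then show ?thesis
        by (intro exI[of _ "{#1, 1, 1, 4#}"] exI[of _ 3] exI[of _ 1] conjI sel_eq_Min)
          (auto simp: N' eval_nat_numeral less_Suc_eq)
    next
      case 4
      then show ?thesis
        by (intro exI[of _ "{#1, 1, 1, b#}"] exI[of _ 2] exI[of _ "b - 2"] conjI sel_eq_Min)
          (auto simp: N' eval_nat_numeral less_Suc_eq)
    qed
  qed
  ultimately show "\<exists>K y z. N = add_mset (y + z) K \<and> y > 0 \<and> sel (add_mset y (add_mset z K)) = y"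
    by (rule repeated_size_5[of N, rotated 2]) (use N in auto)
qed (use assms in auto)

text \<open>
  For \<open>t = 3\<close> and \<open>n = 4\<close> the gap multiset \<open>{0, 2, 2}\<close> gives an isolated component of the digraph,
  so this case needs an explicit cycle (found by a backtracking search).
\<close>

lemma Mcycle_3_4: "is_Mcycle 3 4 [1, 1, 1, 2, 2, 2, 3, 1, 3, 1, 4, 2, 4, 2, 3, 3, 3, 4, 4, 4]"
  (is "is_Mcycle 3 4 ?xs")
proof -
  \<comment> \<open>Sorting represents each window by a list, so distinctness can be evaluated;
    injectivity then passes from the sorted windows to the multisets.\<close>
  have "distinct (map (\<lambda>i. sort (map (\<lambda>j. ?xs ! ((i + j) mod length ?xs)) [0..<3])) [0..<20])"
    by code_simp
  then have "inj_on (sorted_list_of_multiset \<circ> cyclic_window 3 ?xs) {..<20}"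
    unfolding cyclic_window_def comp_def sorted_list_of_multiset_mset distinct_map
    by (simp only: set_upt lessThan_atLeast0)
  then have "inj_on (cyclic_window 3 ?xs) {..<20}"
    by (rule inj_on_imageI2)
  moreover have "length ?xs = 20" by simp
  ultimately have "inj_on (cyclic_window 3 ?xs) {..<length ?xs}" by metis
  moreover have "length ?xs = (4 + 3 - 1) choose 3"
    by (simp add: eval_nat_numeral)
  moreover have "set ?xs \<subseteq> {1..4}" by simp
  ultimately show ?thesis by (simp only: is_Mcycle_def)
qed

theorem theorem2:
  fixes n0 :: "nat \<Rightarrow> nat" and t n :: nat
  assumes "n0 3 = 4" and "n0 4 = 5" and "n0 6 = 11"
    and "t \<in> {3, 4, 6}" and "n \<ge> n0 t" and "gcd n t = 1"
  shows "\<exists>xs. is_Mcycle t n xs"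
proof -
  consider "t = 3" "n = 4" | "t = 3" "n \<ge> 5" | "t = 4" "n \<ge> 5" | "t = 6" "n \<ge> 11"
    using assms by force
  then show ?thesis
  proof cases
    case 1
    then show ?thesis using Mcycle_3_4 by blast
  next
    case 2
    then show ?thesis
      using assms(6) gap_selector.Mcycle_exists[OF gap_selector_3] by simp
  next
    case 3
    then show ?thesis
      using assms(6) gap_selector.Mcycle_exists[OF gap_selector_4] by simp
  next
    case 4
    then show ?thesis
      using assms(6) gap_selector.Mcycle_exists[OF gap_selector_6] by simp
  qed
qed

end
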